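(* Let $G$ be a finite simple graph on the vertex set $V$ with a dominating induced matching. Assume that there is a partition $V = W \sqcup M$, where $W = \{y_1, \ldots, y_r\}$ is an independent set of $G$ and the induced subgraph $G_M$ consists of $m$ pairwise disjoint edges $\{x_{j1}, x_{j2}\}$, $j = 1, \ldots, m$, such that for each $j = 1, \ldots, m$ one of the following holds: (i) $\deg_G x_{j1} = 1$ or $\deg_G x_{j2} = 1$; (ii) $\deg_G x_{j1} = \deg_G x_{j2} = 2$ and there is $y_{i_j} \in W$ with $x_{j1}, x_{j2} \in N_G(y_{i_j})$; (iii) for $\{k, l\} = \{1, 2\}$, $\deg_G x_{jk} = 3$, $\deg_G x_{jl} = 2$, and there is $y_{i_j} \in W$ with $N_G(y_{i_j}) = \{x_{j1}, x_{j2}\}$; (iv) $\deg_G x_{j1} = \deg_G x_{j2} = 3$ and there are three distinct vertices $y_{i_{j1}}, y_{i_{j2}}, y_{i_{j3}} \in W$ such that $\{x_{j1}, y_{i_{j1}}\}, \{x_{j2}, y_{i_{j2}}\} \in E(G)$, $N_G(y_{i_{j3}}) = \{x_{j1}, x_{j2}\}$, and there is a pendant triangle attached to at least one of $y_{i_{j1}}, y_{i_{j2}}$. Then $G$ is vertex decomposable.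
   Context: All graphs are finite and simple. A matching is a set of pairwise disjoint edges; it is maximal if no further edge can be added. An induced matching is a matching such that no edge of $G$ meets two distinct edges of the matching; a dominating induced matching is an induced matching which is also a maximal matching. $G_U$ is the induced subgraph on $U$, $G \setminus U = G_{V \setminus U}$, $G \setminus v = G \setminus \{v\}$. $N_G(x)$ is the set of neighbours of $x$, $N_G[x] = N_G(x) \cup \{x\}$, $\deg_G x = \# N_G(x)$. A set of vertices is independent if no two of its vertices are adjacent. A pendant triangle attached to a vertex $v$ is a triangle of $G$ containing $v$ whose two other vertices have degree $2$ in $G$, while $v$ has degree greater than $2$. $G$ is vertex decomposable if $G$ has no edges, or there is a vertex $v$ such that (VD1) $G \setminus v$ and $G \setminus N_G[v]$ are vertex decomposable, and (VD2) no independent set of $G \setminus N_G[v]$ is a maximal independent set of $G \setminus v$. *)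

theory Defs
  imports "HOL-Library.Disjoint_Sets"
begin

text \<open>Edges are two-element sets of vertices.\<close>

record 'a sgraph =
  verts :: "'a set"
  edges :: "'a set set"

definition finite_simple_graph :: "'a sgraph \<Rightarrow> bool" where
  "finite_simple_graph G \<longleftrightarrow>
     finite (verts G) \<and> (\<forall>e\<in>edges G. e \<subseteq> verts G \<and> card e = 2)"

definition induced_subgraph :: "'a sgraph \<Rightarrow> 'a set \<Rightarrow> 'a sgraph" where
  "induced_subgraph G U = \<lparr>verts = verts G \<inter> U, edges = {e \<in> edges G. e \<subseteq> U}\<rparr>"

definition delete_verts :: "'a sgraph \<Rightarrow> 'a set \<Rightarrow> 'a sgraph" where
  "delete_verts G U = induced_subgraph G (verts G - U)"

definition nbhd :: "'a sgraph \<Rightarrow> 'a \<Rightarrow> 'a set" where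
  "nbhd G x = {y \<in> verts G. {x, y} \<in> edges G}"

definition closed_nbhd :: "'a sgraph \<Rightarrow> 'a \<Rightarrow> 'a set" where
  "closed_nbhd G x = insert x (nbhd G x)"

definition degree :: "'a sgraph \<Rightarrow> 'a \<Rightarrow> nat" where
  "degree G x = card (nbhd G x)"

definition independent_set :: "'a sgraph \<Rightarrow> 'a set \<Rightarrow> bool" where
  "independent_set G S \<longleftrightarrow>
     S \<subseteq> verts G \<and> (\<forall>u\<in>S. \<forall>v\<in>S. {u, v} \<notin> edges G)"

definition maximal_independent_set :: "'a sgraph \<Rightarrow> 'a set \<Rightarrow> bool" where
  "maximal_independent_set G S \<longleftrightarrow>
     independent_set G S \<and> (\<forall>T. independent_set G T \<and> S \<subseteq> T \<longrightarrow> T = S)"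

definition matching :: "'a sgraph \<Rightarrow> 'a set set \<Rightarrow> bool" where
  "matching G F \<longleftrightarrow> F \<subseteq> edges G \<and> pairwise disjnt F"

definition maximal_matching :: "'a sgraph \<Rightarrow> 'a set set \<Rightarrow> bool" where
  "maximal_matching G F \<longleftrightarrow>
     matching G F \<and> (\<forall>e \<in> edges G - F. \<not> matching G (insert e F))"

definition induced_matching :: "'a sgraph \<Rightarrow> 'a set set \<Rightarrow> bool" where
  "induced_matching G F \<longleftrightarrow>
     matching G F \<and>
     (\<forall>e\<in>edges G. \<forall>f\<in>F. \<forall>g\<in>F. f \<noteq> g \<longrightarrow> \<not> (e \<inter> f \<noteq> {} \<and> e \<inter> g \<noteq> {}))"

definition dominating_induced_matching :: "'a sgraph \<Rightarrow> 'a set set \<Rightarrow> bool" where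
  "dominating_induced_matching G F \<longleftrightarrow> induced_matching G F \<and> maximal_matching G F"

text \<open>In a simple graph the three edges already force \<open>v\<close>, \<open>a\<close>, \<open>b\<close> to be distinct.\<close>

definition has_pendant_triangle :: "'a sgraph \<Rightarrow> 'a \<Rightarrow> bool" where
  "has_pendant_triangle G v \<longleftrightarrow>
     (\<exists>a b. {v, a} \<in> edges G \<and> {v, b} \<in> edges G \<and> {a, b} \<in> edges G \<and>
            degree G a = 2 \<and> degree G b = 2 \<and> degree G v > 2)"

inductive vertex_decomposable :: "'a sgraph \<Rightarrow> bool" where
  no_edges: "edges G = {} \<Longrightarrow> vertex_decomposable G"
| shed: "\<lbrakk>v \<in> verts G;
     vertex_decomposable (delete_verts G {v});
     vertex_decomposable (delete_verts G (closed_nbhd G v));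
     \<forall>S. independent_set (delete_verts G (closed_nbhd G v)) S \<longrightarrow>
          \<not> maximal_independent_set (delete_verts G {v}) S\<rbrakk>
    \<Longrightarrow> vertex_decomposable G"

end

theory Submission
  imports Defs
begin

text \<open>
  If a vertex \<open>v\<close> has a simplicial neighbour \<open>s\<close>, then \<open>v\<close> can be shed, since \<open>s\<close> can be added to
  every independent set avoiding the closed neighbourhood of \<open>v\<close>. Hence a graph is vertex
  decomposable as soon as it has an independent set \<open>S\<close> of simplicial vertices whose neighbours
  cover all edges: this property survives both deletions, because a vertex of \<open>S\<close> in the
  deleted closed neighbourhood has all its neighbours there too. In the theorem each matching edge
  contributes one vertex to \<open>S\<close>: its leaf in case (i), one of its ends in case (ii), and the
  degree-two apex of the triangle on it in cases (iii) and (iv).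
\<close>

definition simplicial :: "'a sgraph \<Rightarrow> 'a \<Rightarrow> bool" where
  "simplicial G s \<longleftrightarrow> (\<forall>u\<in>nbhd G s. \<forall>v\<in>nbhd G s. u \<noteq> v \<longrightarrow> {u, v} \<in> edges G)"

lemma edge_ends:
  assumes "finite_simple_graph G" "{u, v} \<in> edges G"
  shows "u \<in> verts G" "v \<in> verts G" "u \<noteq> v"
  using assms unfolding finite_simple_graph_def by fastforce+

lemma edge_at:
  assumes "finite_simple_graph G" "e \<in> edges G" "u \<in> e"
  obtains v where "e = {u, v}" "v \<in> nbhd G u"
proof -
  have "card e = 2" "e \<subseteq> verts G" using assms by (auto simp: finite_simple_graph_def)
  then obtain v where "e = {u, v}" using assms(3) by (auto simp: card_2_iff)
  then show thesis using that assms(2) \<open>e \<subseteq> verts G\<close> by (auto simp: nbhd_def)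
qed

lemma mem_nbhd_iff:
  assumes "finite_simple_graph G"
  shows "v \<in> nbhd G u \<longleftrightarrow> {u, v} \<in> edges G"
  using edge_ends[OF assms] by (auto simp: nbhd_def)

lemma verts_delete_verts [simp]: "verts (delete_verts G U) = verts G - U"
  by (auto simp: delete_verts_def induced_subgraph_def)

lemma edges_delete_verts:
  assumes "finite_simple_graph G"
  shows "e \<in> edges (delete_verts G U) \<longleftrightarrow> e \<in> edges G \<and> e \<inter> U = {}"
  using assms by (auto simp: delete_verts_def induced_subgraph_def finite_simple_graph_def)

lemma finite_simple_graph_delete_verts:
  assumes "finite_simple_graph G"
  shows "finite_simple_graph (delete_verts G U)"
  using assms edges_delete_verts[OF assms, of _ U]
  by (auto simp: finite_simple_graph_def)

lemma nbhd_delete_verts: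
  assumes "finite_simple_graph G" "s \<notin> U"
  shows "nbhd (delete_verts G U) s = nbhd G s - U"
  using assms(2) by (auto simp: nbhd_def edges_delete_verts[OF assms(1)])

lemma simplicial_delete_verts:
  assumes "finite_simple_graph G" "s \<notin> U" "simplicial G s"
  shows "simplicial (delete_verts G U) s"
  using assms(3) unfolding simplicial_def nbhd_delete_verts[OF assms(1,2)]
  by (auto simp: edges_delete_verts[OF assms(1)])

lemma independent_set_delete_verts_iff:
  assumes "finite_simple_graph G"
  shows "independent_set (delete_verts G U) S \<longleftrightarrow> independent_set G S \<and> S \<inter> U = {}"
  by (auto simp: independent_set_def edges_delete_verts[OF assms])

text \<open>A neighbour \<open>u\<close> of \<open>s\<close> other than \<open>v\<close> is adjacent
  to \<open>v\<close>, since \<open>s\<close> is simplicial. A set avoiding the closed neighbourhood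
  of \<open>v\<close> therefore has no neighbour of \<open>s\<close>, and \<open>s\<close> extends
  it.\<close>

lemma simplicial_neighbour_sheds:
  assumes G: "finite_simple_graph G" and s: "simplicial G s" "v \<in> nbhd G s"
    and S: "independent_set (delete_verts G (closed_nbhd G v)) S"
  shows "\<not> maximal_independent_set (delete_verts G {v}) S"
proof
  assume max: "maximal_independent_set (delete_verts G {v}) S"
  have sv: "{s, v} \<in> edges G" using s(2) by (simp add: mem_nbhd_iff[OF G])
  have S': "independent_set G S" "S \<inter> closed_nbhd G v = {}"
    using S by (auto simp: independent_set_delete_verts_iff[OF G])
  have "s \<in> nbhd G v" using sv by (simp add: mem_nbhd_iff[OF G] insert_commute)
  then have "s \<notin> S" using S'(2) by (auto simp: closed_nbhd_def)
  have non: "{s, u} \<notin> edges G" if "u \<in> S" for u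
  proof
    assume su: "{s, u} \<in> edges G"
    have "u \<noteq> v" using that S'(2) by (auto simp: closed_nbhd_def)
    then have "{v, u} \<in> edges G"
      using s su by (auto simp: simplicial_def mem_nbhd_iff[OF G])
    then show False using that S'(2) by (auto simp: closed_nbhd_def mem_nbhd_iff[OF G])
  qed
  \<comment> \<open>\<open>independent_set\<close> also compares a vertex with itself, so the
    degenerate pair has to be excluded.\<close>
  have "{s, s} \<notin> edges G" using edge_ends(3)[OF G] by blast
  then have "independent_set G (insert s S)"
    using S'(1) non edge_ends[OF G sv] by (auto simp: independent_set_def insert_commute)
  then have "independent_set (delete_verts G {v}) (insert s S)"
    using S'(2) edge_ends[OF G sv]
    by (auto simp: independent_set_delete_verts_iff[OF G] closed_nbhd_def)
  then show False using max \<open>s \<notin> S\<close> by (auto simp: maximal_independent_set_def)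
qed

text \<open>Induction on the number of vertices. The shed vertex is a neighbour of a member of
  \<open>S\<close>, hence outside \<open>S\<close> by independence, and \<open>S - U\<close>
  inherits all hypotheses after each deletion.\<close>

theorem vertex_decomposable_simplicial_cover:
  assumes "finite_simple_graph G" "independent_set G S" "\<forall>s\<in>S. simplicial G s"
    and "\<forall>e\<in>edges G. \<exists>s\<in>S. e \<inter> nbhd G s \<noteq> {}"
  shows "vertex_decomposable G"
  using assms
proof (induction "card (verts G)" arbitrary: G S rule: less_induct)
  case less
  note G = less.prems(1) and S = less.prems(2,3) and cover = less.prems(4)
  show ?case
  proof (cases "edges G = {}")
    case True
    then show ?thesis by (rule no_edges)
  next
    case False
    then obtain s v where s: "s \<in> S" and vs: "v \<in> nbhd G s" using cover by blast
    have v: "v \<in> verts G" using vs by (simp add: nbhd_def)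
    have "v \<notin> S" using S(1) s vs by (auto simp: independent_set_def nbhd_def)
    \<comment> \<open>Treats both deletions at once. The closure condition on \<open>U\<close> keeps
      the cover intact: a deleted member of \<open>S\<close> takes its neighbours along, so it
      covers no surviving edge.\<close>
    have step: "vertex_decomposable (delete_verts G U)"
      if "v \<in> U" and U: "\<And>t u. t \<in> S \<inter> U \<Longrightarrow> u \<in> nbhd G t \<Longrightarrow> u \<in> U" for U
    proof (rule less.hyps)
      show "card (verts (delete_verts G U)) < card (verts G)"
        using G v \<open>v \<in> U\<close> by (intro psubset_card_mono) (auto simp: finite_simple_graph_def)
      show "finite_simple_graph (delete_verts G U)"
        by (rule finite_simple_graph_delete_verts[OF G])
      show "independent_set (delete_verts G U) (S - U)"
        using S(1) unfolding independent_set_delete_verts_iff[OF G]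
        by (auto simp: independent_set_def)
      show "\<forall>t\<in>S - U. simplicial (delete_verts G U) t"
        using S(2) by (auto intro: simplicial_delete_verts[OF G])
      show "\<forall>e\<in>edges (delete_verts G U). \<exists>t\<in>S - U. e \<inter> nbhd (delete_verts G U) t \<noteq> {}"
      proof
        fix e assume "e \<in> edges (delete_verts G U)"
        then have e: "e \<in> edges G" "e \<inter> U = {}" by (auto simp: edges_delete_verts[OF G])
        then obtain t u where t: "t \<in> S" "u \<in> e" "u \<in> nbhd G t" using cover by blast
        then have "t \<notin> U" using U e(2) by blast
        then show "\<exists>t\<in>S - U. e \<inter> nbhd (delete_verts G U) t \<noteq> {}"
          using t e(2) nbhd_delete_verts[OF G] by blast
      qed
    qed
    \<comment> \<open>The closure condition for the closed neighbourhood: \<open>t\<close> differs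
      from \<open>v\<close>, so \<open>v\<close> is a neighbour of the simplicial vertex
      \<open>t\<close>, and every other neighbour of \<open>t\<close> is adjacent to
      \<open>v\<close>.\<close>
    have "u \<in> closed_nbhd G v" if t: "t \<in> S \<inter> closed_nbhd G v" and u: "u \<in> nbhd G t" for t u
    proof -
      have "v \<in> nbhd G t"
        using t \<open>v \<notin> S\<close> by (auto simp: closed_nbhd_def mem_nbhd_iff[OF G] insert_commute)
      then show ?thesis
        using t u S(2) unfolding simplicial_def closed_nbhd_def
        by (metis IntD1 insert_iff mem_nbhd_iff[OF G])
    qed
    then have "vertex_decomposable (delete_verts G (closed_nbhd G v))"
      by (intro step) (auto simp: closed_nbhd_def)
    \<comment> \<open>Here the closure condition is vacuous, as \<open>S\<close> misses
      \<open>v\<close>.\<close>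
    moreover have "vertex_decomposable (delete_verts G {v})"
      using \<open>v \<notin> S\<close> by (intro step) auto
    ultimately show ?thesis
      using v simplicial_neighbour_sheds[OF G _ vs] S(2) s by (blast intro: shed)
  qed
qed

text \<open>The vertex that a matching edge \<open>e\<close> contributes to \<open>S\<close>.\<close>

definition edge_rep :: "'a sgraph \<Rightarrow> 'a set \<Rightarrow> 'a set \<Rightarrow> 'a \<Rightarrow> bool" where
  "edge_rep G W e s \<longleftrightarrow> (s \<in> e \<or> s \<in> W \<and> nbhd G s = e) \<and> simplicial G s \<and>
     (\<forall>f\<in>edges G. f \<inter> e \<noteq> {} \<longrightarrow> f \<inter> nbhd G s \<noteq> {})"

text \<open>Case (i): \<open>p\<close> is the only neighbour of \<open>q\<close>, so an edge through
  \<open>q\<close> also contains \<open>p\<close>.\<close>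

lemma edge_rep_leaf:
  assumes G: "finite_simple_graph G" and e: "{p, q} \<in> edges G" and deg: "degree G q = 1"
  shows "edge_rep G W {p, q} q"
proof -
  have "p \<in> nbhd G q" using e by (simp add: mem_nbhd_iff[OF G] insert_commute)
  then have N: "nbhd G q = {p}" using deg unfolding degree_def by (auto simp: card_1_singleton_iff)
  have "f \<inter> {p} \<noteq> {}" if f: "f \<in> edges G" "f \<inter> {p, q} \<noteq> {}" for f
    using f N by (auto elim!: edge_at[OF G])
  then show ?thesis unfolding edge_rep_def simplicial_def N by auto
qed

text \<open>Cases (iii) and (iv): the neighbourhood of the apex is the matching edge itself, which
  gives both simpliciality and covering.\<close>

lemma edge_rep_apex:
  assumes "{p, q} \<in> edges G" "y \<in> W" "nbhd G y = {p, q}"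
  shows "edge_rep G W {p, q} y"
  using assms by (auto simp: edge_rep_def simplicial_def insert_commute)

text \<open>Case (ii): degree two leaves \<open>p\<close> only the neighbours \<open>q\<close> and
  \<open>y\<close>, which are adjacent. An edge meeting the matching edge contains \<open>q\<close>,
  or joins \<open>p\<close> to one of these two.\<close>

lemma edge_rep_triangle:
  assumes G: "finite_simple_graph G" and e: "{p, q} \<in> edges G" and deg: "degree G p = 2"
    and y: "p \<in> nbhd G y" "q \<in> nbhd G y"
  shows "edge_rep G W {p, q} p"
proof -
  have yE: "{y, p} \<in> edges G" "{y, q} \<in> edges G" using y by (auto simp: mem_nbhd_iff[OF G])
  then have "y \<noteq> q" using edge_ends(3)[OF G] by blast
  moreover have "q \<in> nbhd G p" "y \<in> nbhd G p"
    using e yE by (auto simp: mem_nbhd_iff[OF G] insert_commute)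
  ultimately have N: "nbhd G p = {q, y}"
    using deg unfolding degree_def card_2_iff by auto
  have "f \<inter> {q, y} \<noteq> {}" if f: "f \<in> edges G" "f \<inter> {p, q} \<noteq> {}" for f
  proof (cases "p \<in> f")
    case True
    then show ?thesis using f N by (auto elim!: edge_at[OF G])
  qed (use f in auto)
  then show ?thesis
    using yE unfolding edge_rep_def simplicial_def N by (auto simp: insert_commute)
qed

theorem theorem3p1:
  fixes G :: "'a sgraph" and W M :: "'a set"
    and m :: nat and x :: "nat \<Rightarrow> nat \<Rightarrow> 'a"
  assumes graph: "finite_simple_graph G"
    and dim: "\<exists>F. dominating_induced_matching G F"
    and partition: "verts G = W \<union> M" "W \<inter> M = {}"
    and indep: "independent_set G W"
    and GM: "induced_subgraph G M =
               \<lparr>verts = (\<Union>j\<in>{1..m}. {x j 1, x j 2}), edges = (\<lambda>j. {x j 1, x j 2}) ` {1..m}\<rparr>"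
            "disjoint_family_on (\<lambda>j. {x j 1, x j 2}) {1..m}"
    and cases: "\<forall>j\<in>{1..m}.
        (degree G (x j 1) = 1 \<or> degree G (x j 2) = 1)
      \<or> (degree G (x j 1) = 2 \<and> degree G (x j 2) = 2 \<and>
         (\<exists>y\<in>W. x j 1 \<in> nbhd G y \<and> x j 2 \<in> nbhd G y))
      \<or> (\<exists>k l. {k, l} = {1, 2} \<and> degree G (x j k) = 3 \<and> degree G (x j l) = 2 \<and>
         (\<exists>y\<in>W. nbhd G y = {x j 1, x j 2}))
      \<or> (degree G (x j 1) = 3 \<and> degree G (x j 2) = 3 \<and>
         (\<exists>y1\<in>W. \<exists>y2\<in>W. \<exists>y3\<in>W. y1 \<noteq> y2 \<and> y1 \<noteq> y3 \<and> y2 \<noteq> y3 \<and>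
            {x j 1, y1} \<in> edges G \<and> {x j 2, y2} \<in> edges G \<and>
            nbhd G y3 = {x j 1, x j 2} \<and>
            (has_pendant_triangle G y1 \<or> has_pendant_triangle G y2)))"
  shows "vertex_decomposable G"
proof -
  define e where "e j = {x j 1, x j 2}" for j
  have M: "M = (\<Union>j\<in>{1..m}. e j)"
    using GM(1) partition(1) by (auto simp: induced_subgraph_def e_def)
  have ME: "{f \<in> edges G. f \<subseteq> M} = e ` {1..m}"
    using GM(1) by (simp add: induced_subgraph_def e_def)
  have disj: "e i \<inter> e j = {}" if "i \<in> {1..m}" "j \<in> {1..m}" "i \<noteq> j" for i j
    using GM(2) that by (simp add: disjoint_family_on_def e_def)
  have "\<exists>s. edge_rep G W (e j) s" if j: "j \<in> {1..m}" for j
  proof -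
    have E: "{x j 1, x j 2} \<in> edges G" using ME j by (auto simp: e_def)
    \<comment> \<open>\<open>edge_rep_leaf\<close> expects the leaf as second end, so a leaf
      \<open>x j 1\<close> needs the swapped edge.\<close>
    then have E': "{x j 2, x j 1} \<in> edges G" by (simp add: insert_commute)
    from bspec[OF cases j] show ?thesis
      unfolding e_def
    proof (elim disjE)
      assume "degree G (x j 1) = 1"
      then show "\<exists>s. edge_rep G W {x j 1, x j 2} s"
        using edge_rep_leaf[OF graph E'] by (auto simp: insert_commute)
    next
      assume "degree G (x j 2) = 1"
      then show "\<exists>s. edge_rep G W {x j 1, x j 2} s"
        using edge_rep_leaf[OF graph E] by auto
    qed (use edge_rep_apex[OF E] edge_rep_triangle[OF graph E] in blast)+
  qed
  then obtain s where s: "\<And>j. j \<in> {1..m} \<Longrightarrow> edge_rep G W (e j) (s j)" by metis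
  have sV: "s j \<in> verts G" if "j \<in> {1..m}" for j
    using s[OF that] that partition(1) M by (auto simp: edge_rep_def)
  \<comment> \<open>Independence of the chosen vertices rests on the matching edges being disjoint
    and being all the edges inside \<open>M\<close>.\<close>
  have nonadj: "{s i, s j} \<notin> edges G" if ij: "i \<in> {1..m}" "j \<in> {1..m}" for i j
  proof
    assume adj: "{s i, s j} \<in> edges G"
    then have "s i \<noteq> s j" by (rule edge_ends(3)[OF graph])
    then have ne: "i \<noteq> j" by auto
    have nb: "s j \<in> nbhd G (s i)" "s i \<in> nbhd G (s j)"
      using adj by (auto simp: mem_nbhd_iff[OF graph] insert_commute)
    have sub: "e i \<subseteq> M" "e j \<subseteq> M" using M ij by auto
    consider "s i \<in> e i" "s j \<in> e j" | "s i \<in> W" "nbhd G (s i) = e i" | "s j \<in> W" "nbhd G (s j) = e j"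
      using s ij by (auto simp: edge_rep_def)
    then show False
    proof cases
      case 1
      then have "{s i, s j} \<in> e ` {1..m}" using adj sub ME by auto
      then obtain k where k: "k \<in> {1..m}" "{s i, s j} = e k" by blast
      then have "s i \<in> e k" "s j \<in> e k" by auto
      \<comment> \<open>\<open>e k\<close> would meet both \<open>e i\<close> and
        \<open>e j\<close>, so \<open>k\<close> would equal both indices.\<close>
      then show False using disj ij ne k(1) 1 by blast
    next
      case 2
      \<comment> \<open>Now \<open>s j\<close> lies in \<open>e i\<close>, hence in
        \<open>M\<close>. It is thus not an apex in \<open>W\<close> but an end of
        \<open>e j\<close>, which is disjoint from \<open>e i\<close>.\<close>
      then show False using nb sub s[OF ij(2)] disj[OF ij ne] partition(2)
        by (auto simp: edge_rep_def)
    next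
      case 3
      then show False using nb sub s[OF ij(1)] disj[OF ij ne] partition(2)
        by (auto simp: edge_rep_def)
    qed
  qed
  show ?thesis
  proof (rule vertex_decomposable_simplicial_cover[OF graph])
    show "independent_set G (s ` {1..m})" using sV nonadj by (auto simp: independent_set_def)
    show "\<forall>t\<in>s ` {1..m}. simplicial G t" using s by (auto simp: edge_rep_def)
    show "\<forall>f\<in>edges G. \<exists>t\<in>s ` {1..m}. f \<inter> nbhd G t \<noteq> {}"
    proof
      fix f assume f: "f \<in> edges G"
      then obtain u v where uv: "f = {u, v}" "f \<subseteq> W \<union> M"
        using graph partition(1) by (fastforce simp: finite_simple_graph_def card_2_iff)
      \<comment> \<open>No edge lies inside the independent set \<open>W\<close>, so every edge
        meets some matching edge and is covered by its representative.\<close>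
      then have "f \<inter> M \<noteq> {}" using f indep by (auto simp: independent_set_def)
      then obtain j where "j \<in> {1..m}" "f \<inter> e j \<noteq> {}" using M by blast
      then show "\<exists>t\<in>s ` {1..m}. f \<inter> nbhd G t \<noteq> {}"
        using s f unfolding edge_rep_def by blast
    qed
  qed
qed

end
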